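(* Let $\mathbb{G},\mathbb{K}\subseteq\mathbb{S}^n_+$ be closed convex cones with $\mathbb{G}\subseteq\mathbb{K}$, let $Q\in\mathbb{S}^n$, let $O\neq H\in\mathbb{S}^n$, let $\mathcal{B}=\{B^k:1\le k\le m\}\subseteq\mathbb{S}^n$ be a finite set, and let $\mathbb{F}_{\mathbb{K}}$ be a face of $\mathbb{K}$ such that $\mathbb{G}\subseteq\mathbb{F}_{\mathbb{K}}$ (hence $\mathbb{G}=\mathbb{F}_{\mathbb{K}}\cap\mathbb{G}$). Assume that the following four conditions hold. (C1) If $\mathrm{COP}(\mathbb{G},Q,H)$ is solvable, then it is exact (as a convex relaxation of $\mathrm{COP}(\Gamma^n\cap\mathbb{G},Q,H)$). (C2) $\mathbb{J}_0(B)\subseteq\mathbb{K}$ and $\mathbb{F}_{\mathbb{K}}\cap\mathbb{J}_0(B)\subseteq\mathbb{G}$ for every $B\in\mathcal{B}$. (C3) $\mathbb{F}_{\mathbb{K}}\cap\mathbb{J}_0(B)\subseteq\mathbb{F}_{\mathbb{K}}\cap\mathbb{J}_+(B')$ for every distinct $B,B'\in\mathcal{B}$. (C4) $\mathrm{COP}(\mathbb{G}\cap\mathbb{J}_+(\mathcal{B}),Q,H)$ has an optimal solution $X$ at which the following KKT stationary condition holds for some $(\bar t,\bar y,\overline{Y})\in\mathbb{R}\times\mathbb{R}^m\times\mathbb{S}^n$: - (primal feasibility) $X\in\mathbb{F}_{\mathbb{K}}\cap\mathbb{G}$, $\langle B^k,X\rangle\ge 0$ $(1\le k\le m)$, $\langle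 H,X\rangle=1$; - (dual feasibility) $\bar y\ge 0$, $Q-H\bar t-\sum_{k=1}^m\bar y_kB^k=\overline{Y}\in(\mathbb{F}_{\mathbb{K}}\cap\mathbb{G})^*$; - (complementarity) $\sum_{k=1}^m\bar y_k\langle B^k,X\rangle=0$ and $\langle\overline{Y},X\rangle=0$; here $(\bar t,\bar y,\overline{Y})$ corresponds to an optimal solution of the dual of $\mathrm{COP}(\mathbb{F}_{\mathbb{K}}\cap\mathbb{G}\cap\mathbb{J}_+(\mathcal{B}),Q,H)$. Then $\mathrm{COP}(\mathbb{G}\cap\mathbb{J}_+(\mathcal{B}),Q,H)$ is an exact convex relaxation of $\mathrm{COP}(\Gamma^n\cap\mathbb{G}\cap\mathbb{J}_+(\mathcal{B}),Q,H)$.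
   Context: Notation. $\mathbb{S}^n$ is the space of $n\times n$ real symmetric matrices with inner product $\langle A,X\rangle=\sum_{i,j}A_{ij}X_{ij}$; $\mathbb{S}^n_+$ is the cone of positive semidefinite matrices in $\mathbb{S}^n$; $O$ is the zero matrix; $\Gamma^n=\{xx^T:x\in\mathbb{R}^n\}$. A set $\mathbb{C}\subseteq\mathbb{S}^n_+$ is a cone if $\lambda X\in\mathbb{C}$ for all $\lambda\ge0$ and $X\in\mathbb{C}$. For a cone $\mathbb{C}\subseteq\mathbb{S}^n$, $\mathbb{C}^*=\{Y\in\mathbb{S}^n:\langle Y,X\rangle\ge0\ \text{for all }X\in\mathbb{C}\}$ is its dual cone. For $A\in\mathbb{S}^n$ and $\mathcal{A}\subseteq\mathbb{S}^n$: $\mathbb{J}_0(A)=\{X\in\mathbb{S}^n_+:\langle A,X\rangle=0\}$, $\mathbb{J}_+(A)=\{X\in\mathbb{S}^n_+:\langle A,X\rangle\ge0\}$, and $\mathbb{J}_+(\mathcal{A})=\{X\in\mathbb{S}^n_+:\langle A,X\rangle\ge0\text{ for all }A\in\mathcal{A}\}$. For a closed cone $\mathbb{C}\subseteq\mathbb{S}^n_+$ (not necessarily convex), $Q\in\mathbb{S}^n$ and $O\ne H\in\mathbb{S}^n$, $\mathrm{COP}(\mathbb{C},Q,H)$ denotes the problem of minimizing $\langle Q,X\rangle$ subject to $X\in\mathbb{C}$ and $\langle H,X\rangle=1$. Its optimal value is $$\eta(\mathbb{C},Q,H)=\inf\{\langle Q,X\rangle:X\in\mathbb{C},\ \langle H,X\rangle=1\},$$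 with $\eta(\mathbb{C},Q,H)=+\infty$ if infeasible. The problem is called solvable if it has an optimal solution (the infimum is attained). For a closed convex cone $\mathbb{G}'\subseteq\mathbb{S}^n_+$, $\mathrm{COP}(\mathbb{G}',Q,H)$ is a convex relaxation of the (conic-form) quadratically constrained quadratic program $\mathrm{COP}(\Gamma^n\cap\mathbb{G}',Q,H)$. It is called an exact convex relaxation (or simply exact) if $\mathrm{COP}(\mathbb{G}',Q,H)$ has an optimal solution $X\in\Gamma^n$; such an $X$ is then an optimal solution of $\mathrm{COP}(\Gamma^n\cap\mathbb{G}',Q,H)$. The dual of $\mathrm{COP}(\mathbb{F}_{\mathbb{K}}\cap\mathbb{G}\cap\mathbb{J}_+(\mathcal{B}),Q,H)$ referred to in (C4) is the problem of maximizing $t$ subject to $y\ge0$ and $Q-Ht-\sum_{k=1}^m y_kB^k=Y\in(\mathbb{F}_{\mathbb{K}}\cap\mathbb{G})^*$ over $(t,y,Y)\in\mathbb{R}\times\mathbb{R}^m\times\mathbb{S}^n$. A face of a closed convex cone $\mathbb{K}$ is a convex cone $\mathbb{F}\subseteq\mathbb{K}$ such that $X,Y\in\mathbb{K}$ and $X+Y\in\mathbb{F}$ imply $X,Y\in\mathbb{F}$. *)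

theory Defs
  imports "HOL-Analysis.Analysis"
begin

(* The inner product (\<bullet>) on real^'n^'n is the entrywise one, the sum of A$i$j * X$i$j. *)

definition sym_mats :: "(real^'n^'n) set" where
  "sym_mats = {A. transpose A = A}"

definition psd_mats :: "(real^'n^'n) set" where
  "psd_mats = {A \<in> sym_mats. \<forall>x. 0 \<le> x \<bullet> (A *v x)}"

definition Gamma :: "(real^'n^'n) set" where
  "Gamma = range (\<lambda>x::real^'n. \<chi> i j. x $ i * x $ j)"

definition closed_convex_psd_cone :: "(real^'n^'n) set \<Rightarrow> bool" where
  "closed_convex_psd_cone C \<longleftrightarrow> C \<subseteq> psd_mats \<and> cone C \<and> convex C \<and> closed C"

(* A convex cone with the additive face condition, instead of the library's face_of,
   which uses open segments and does not ask for a cone. *)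
definition cone_face :: "(real^'n^'n) set \<Rightarrow> (real^'n^'n) set \<Rightarrow> bool" where
  "cone_face F K \<longleftrightarrow> F \<subseteq> K \<and> cone F \<and> convex F \<and>
     (\<forall>X\<in>K. \<forall>Y\<in>K. X + Y \<in> F \<longrightarrow> X \<in> F \<and> Y \<in> F)"

definition dual_cone :: "(real^'n^'n) set \<Rightarrow> (real^'n^'n) set" where
  "dual_cone C = {Y \<in> sym_mats. \<forall>X\<in>C. 0 \<le> Y \<bullet> X}"

definition J_zero :: "real^'n^'n \<Rightarrow> (real^'n^'n) set" where
  "J_zero A = {X \<in> psd_mats. A \<bullet> X = 0}"

definition J_plus :: "real^'n^'n \<Rightarrow> (real^'n^'n) set" where
  "J_plus A = {X \<in> psd_mats. 0 \<le> A \<bullet> X}"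

definition J_plus_set :: "(real^'n^'n) set \<Rightarrow> (real^'n^'n) set" where
  "J_plus_set \<A> = {X \<in> psd_mats. \<forall>A\<in>\<A>. 0 \<le> A \<bullet> X}"

definition cop_feasible :: "(real^'n^'n) set \<Rightarrow> real^'n^'n \<Rightarrow> (real^'n^'n) set" where
  "cop_feasible C H = {X \<in> C. H \<bullet> X = 1}"

(* Equal to \<infinity> when the problem is infeasible, since the infimum of {} in ereal is \<infinity>. *)
definition cop_value :: "(real^'n^'n) set \<Rightarrow> real^'n^'n \<Rightarrow> real^'n^'n \<Rightarrow> ereal" where
  "cop_value C Q H = (INF X\<in>cop_feasible C H. ereal (Q \<bullet> X))"

definition cop_optimal ::
    "(real^'n^'n) set \<Rightarrow> real^'n^'n \<Rightarrow> real^'n^'n \<Rightarrow> real^'n^'n \<Rightarrow> bool" where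
  "cop_optimal C Q H X \<longleftrightarrow> X \<in> cop_feasible C H \<and> ereal (Q \<bullet> X) = cop_value C Q H"

definition cop_solvable :: "(real^'n^'n) set \<Rightarrow> real^'n^'n \<Rightarrow> real^'n^'n \<Rightarrow> bool" where
  "cop_solvable C Q H \<longleftrightarrow> (\<exists>X. cop_optimal C Q H X)"

(* COP(C,Q,H), for a closed convex cone C of psd matrices, is exact as a convex relaxation
   of COP(Gamma \<inter> C,Q,H). *)
definition exact_convex_relaxation ::
    "(real^'n^'n) set \<Rightarrow> real^'n^'n \<Rightarrow> real^'n^'n \<Rightarrow> bool" where
  "exact_convex_relaxation C Q H \<longleftrightarrow> (\<exists>X\<in>Gamma. cop_optimal C Q H X)"

(* The dual of COP(C \<inter> J_plus_set {B 1, ..., B m},Q,H): maximize t. Only B k and y k with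
   1 \<le> k \<le> m are used, so y stands for a vector in R^m. *)
definition dual_feasible ::
    "(real^'n^'n) set \<Rightarrow> real^'n^'n \<Rightarrow> real^'n^'n \<Rightarrow> nat \<Rightarrow> (nat \<Rightarrow> real^'n^'n) \<Rightarrow>
     real \<Rightarrow> (nat \<Rightarrow> real) \<Rightarrow> real^'n^'n \<Rightarrow> bool" where
  "dual_feasible C Q H m B t y Y \<longleftrightarrow>
     (\<forall>k\<in>{1..m}. 0 \<le> y k) \<and>
     Q - t *\<^sub>R H - (\<Sum>k=1..m. y k *\<^sub>R B k) = Y \<and> Y \<in> dual_cone C"

definition dual_optimal ::
    "(real^'n^'n) set \<Rightarrow> real^'n^'n \<Rightarrow> real^'n^'n \<Rightarrow> nat \<Rightarrow> (nat \<Rightarrow> real^'n^'n) \<Rightarrow>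
     real \<Rightarrow> (nat \<Rightarrow> real) \<Rightarrow> real^'n^'n \<Rightarrow> bool" where
  "dual_optimal C Q H m B t y Y \<longleftrightarrow>
     dual_feasible C Q H m B t y Y \<and>
     (\<forall>t' y' Y'. dual_feasible C Q H m B t' y' Y' \<longrightarrow> t' \<le> t)"

definition kkt ::
    "(real^'n^'n) set \<Rightarrow> real^'n^'n \<Rightarrow> real^'n^'n \<Rightarrow> nat \<Rightarrow> (nat \<Rightarrow> real^'n^'n) \<Rightarrow>
     real^'n^'n \<Rightarrow> real \<Rightarrow> (nat \<Rightarrow> real) \<Rightarrow> real^'n^'n \<Rightarrow> bool" where
  "kkt C Q H m B X t y Y \<longleftrightarrow>
     (X \<in> C \<and> (\<forall>k\<in>{1..m}. 0 \<le> B k \<bullet> X) \<and> H \<bullet> X = 1) \<and>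
     dual_feasible C Q H m B t y Y \<and>
     (\<Sum>k=1..m. y k * (B k \<bullet> X)) = 0 \<and> Y \<bullet> X = 0"

(* By weak duality, the multipliers of a KKT point always solve the dual problem. *)
lemma kkt_imp_dual_optimal:
  assumes "kkt C Q H m B X t y Y"
  shows "dual_optimal C Q H m B t y Y"
proof -
  have feas: "dual_feasible C Q H m B t y Y"
    and X: "X \<in> C" "\<forall>k\<in>{1..m}. 0 \<le> B k \<bullet> X" "H \<bullet> X = 1"
    and compl: "(\<Sum>k=1..m. y k * (B k \<bullet> X)) = 0" "Y \<bullet> X = 0"
    using assms by (auto simp: kkt_def)
  have expand: "Y' \<bullet> X = Q \<bullet> X - t' - (\<Sum>k=1..m. y' k * (B k \<bullet> X))"
    if "dual_feasible C Q H m B t' y' Y'" for t' y' Y'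
    using that X(3) by (auto simp: dual_feasible_def inner_diff_left inner_sum_left)
  have "t' \<le> t" if d: "dual_feasible C Q H m B t' y' Y'" for t' y' Y'
  proof -
    have "0 \<le> Y' \<bullet> X"
      using d X(1) by (auto simp: dual_feasible_def dual_cone_def)
    moreover have "0 \<le> (\<Sum>k=1..m. y' k * (B k \<bullet> X))"
      using d X(2) by (intro sum_nonneg mult_nonneg_nonneg) (auto simp: dual_feasible_def)
    ultimately show ?thesis
      using expand[OF d] expand[OF feas] compl by linarith
  qed
  then show ?thesis
    using feas by (auto simp: dual_optimal_def)
qed

end

theory Submission
  imports Defs
begin

text \<open>
  Let \<open>t\<close> be the multiplier of the normalization \<open>H \<bullet> X = 1\<close>. By the KKT condition \<open>Q - t H\<close> is a
  nonnegative combination of the matrices in \<open>\<B>\<close> plus an element of the dual cone of \<open>G\<close>. Hence it is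
  nonnegative on the relaxation cone \<open>G \<inter> J\<^sub>+(\<B>)\<close>, and by complementarity it vanishes at the given
  optimal solution. So \<open>t\<close> is the optimal value, and up to scaling a rank-one optimal solution is a
  rank-one matrix of this cone at which \<open>Q - t H\<close> vanishes and \<open>H\<close> is positive.

  Suppose first that some constraint \<open>A \<in> \<B>\<close> is active at the optimal solution \<open>X\<close>. A positive
  semidefinite \<open>X\<close> with \<open>A \<bullet> X = 0\<close> is a sum of rank-one matrices \<open>x x\<^sup>T\<close> that all satisfy
  \<open>A \<bullet> x x\<^sup>T = 0\<close> (lemma \<open>psd_null_decomposition\<close>, due to Sturm and Zhang). By (C2) these pieces lie
  in \<open>K\<close>; their sum lies in the face, hence so does each of them, and (C2) and (C3) put them in
  \<open>G \<inter> J\<^sub>+(\<B>)\<close>. The nonnegative objective \<open>Q - t H\<close> sums to zero over the pieces, so it vanishes at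
  each of them, while \<open>H\<close> sums to one, so that some piece has a positive value of \<open>H\<close>. That piece,
  rescaled, is the rank-one optimal solution (lemma \<open>exact_if_active_constraint\<close>).

  If instead every constraint is strictly positive at \<open>X\<close>, complementarity makes all multipliers of the
  constraints vanish. Then \<open>X\<close> is already optimal over the whole of \<open>G\<close>, and (C1) yields a rank-one solution
  \<open>X'\<close> there. Either \<open>X'\<close> satisfies all constraints, or it violates some \<open>A\<close>; in that case the
  segment from \<open>X\<close> to \<open>X'\<close> consists of optimal solutions over \<open>G\<close> and crosses the hyperplane
  \<open>A \<bullet> Z = 0\<close>. By (C3) the crossing point satisfies the other constraints as well, and the first
  case applies to it.
\<close>

section \<open>Rank-one matrices and positive semidefinite forms\<close>

definition outer :: "real^'n \<Rightarrow> real^'n^'n" where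
  "outer x = (\<chi> i j. x $ i * x $ j)"

lemma Gamma_eq_range_outer: "Gamma = range outer"
  by (simp add: Gamma_def outer_def[abs_def])

lemma inner_outer: "A \<bullet> outer x = x \<bullet> (A *v x)"
  by (simp add: outer_def inner_vec_def matrix_vector_mult_def sum_distrib_left algebra_simps)

lemma outer_mult_vec: "outer x *v y = (x \<bullet> y) *\<^sub>R x"
  by (simp add: outer_def vec_eq_iff inner_vec_def matrix_vector_mult_def
      sum_distrib_left sum_distrib_right algebra_simps)

lemma outer_scaleR: "outer (c *\<^sub>R x) = c\<^sup>2 *\<^sub>R outer x"
  by (simp add: outer_def vec_eq_iff power2_eq_square algebra_simps)

lemma sym_mats_inner_commute:
  assumes "A \<in> sym_mats"
  shows "x \<bullet> (A *v y) = y \<bullet> (A *v x)"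
  using assms dot_lmul_matrix[of x A y]
  by (metis (mono_tags, lifting) inner_commute mem_Collect_eq sym_mats_def
      transpose_matrix_vector)

lemma sym_mats_diff_scaleR:
  assumes "A \<in> sym_mats" "C \<in> sym_mats"
  shows "A - c *\<^sub>R C \<in> sym_mats"
  using assms by (simp add: sym_mats_def transpose_def vec_eq_iff)

lemma outer_in_psd_mats: "outer x \<in> psd_mats"
proof -
  have "outer x \<in> sym_mats"
    by (simp add: sym_mats_def transpose_def outer_def vec_eq_iff mult.commute)
  moreover have "0 \<le> y \<bullet> (outer x *v y)" for y
    by (simp add: outer_mult_vec inner_commute)
  ultimately show ?thesis
    by (simp add: psd_mats_def)
qed

text \<open>Polarization: a symmetric form is determined by its values on the diagonal.\<close>
lemma sym_mats_zero_form_imp_zero: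
  fixes A :: "real^'n^'n"
  assumes A: "A \<in> sym_mats" and zero: "\<And>v. v \<bullet> (A *v v) = 0"
  shows "A = 0"
proof -
  have "u \<bullet> (A *v v) = 0" for u v
    using zero[of "u + v"] zero[of u] zero[of v] sym_mats_inner_commute[OF A, of u v]
    by (simp add: matrix_vector_right_distrib inner_add_left inner_add_right)
  then have "A *v v = 0" for v
    by (metis inner_eq_zero_iff)
  then show ?thesis
    by (simp add: matrix_eq)
qed

text \<open>
  One step of a Cholesky factorization along \<open>v\<close>. The value of the new form at \<open>w\<close> is that of the old
  form at the component \<open>w - s v\<close> of \<open>w\<close> that is orthogonal to \<open>v\<close> with respect to the old form, hence
  it is nonnegative.
\<close>
lemma psd_split_off_outer:
  fixes A :: "real^'n^'n"
  assumes A: "A \<in> psd_mats" and v: "0 < v \<bullet> (A *v v)"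
  defines "A' \<equiv> A - (1 / (v \<bullet> (A *v v))) *\<^sub>R outer (A *v v)"
  shows "A' \<in> psd_mats"
    and "A *v u = 0 \<Longrightarrow> A' *v u = 0"
    and "A' *v v = 0"
proof -
  define c where "c = v \<bullet> (A *v v)"
  have sym: "A \<in> sym_mats" and psd: "\<And>x. 0 \<le> x \<bullet> (A *v x)"
    using A by (auto simp: psd_mats_def)
  have c: "c > 0"
    using v by (simp add: c_def)
  have A': "A' *v w = A *v w - (((A *v v) \<bullet> w) / c) *\<^sub>R (A *v v)" for w
    by (simp add: A'_def c_def matrix_vector_mult_diff_rdistrib outer_mult_vec
        scaleR_matrix_vector_assoc[symmetric])
  have "0 \<le> w \<bullet> (A' *v w)" for w
  proof -
    define s where "s = (w \<bullet> (A *v v)) / c"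
    have sc: "w \<bullet> (A *v v) = s * c"
      using c by (simp add: s_def)
    have "(w - s *\<^sub>R v) \<bullet> (A *v (w - s *\<^sub>R v)) = w \<bullet> (A *v w) - s * (s * c)"
      using sym_mats_inner_commute[OF sym, of v w] sc
      by (simp add: matrix_vector_mult_diff_distrib matrix_vector_mult_scaleR
          inner_diff_left inner_diff_right c_def[symmetric] algebra_simps)
    also have "\<dots> = w \<bullet> (A' *v w)"
      using sc c by (simp add: A' inner_diff_right inner_commute[of "A *v v"])
    finally show ?thesis
      using psd by metis
  qed
  moreover have "A' \<in> sym_mats"
    unfolding A'_def using sym outer_in_psd_mats[of "A *v v"]
    by (intro sym_mats_diff_scaleR) (auto simp: psd_mats_def)
  ultimately show "A' \<in> psd_mats"
    by (simp add: psd_mats_def)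
  show "A' *v u = 0" if "A *v u = 0"
    using that sym_mats_inner_commute[OF sym, of u v] by (simp add: A' inner_commute)
  show "A' *v v = 0"
    using c by (simp add: A' c_def inner_commute)
qed

text \<open>Splitting off rank-one terms ends because the kernel grows at each step.\<close>
lemma psd_sum_outer:
  fixes A :: "real^'n^'n"
  assumes "A \<in> psd_mats"
  shows "\<exists>xs. A = (\<Sum>x\<leftarrow>xs. outer x)"
  using assms
proof (induction "CARD('n) - dim {x. A *v x = 0}" arbitrary: A rule: less_induct)
  case less
  show ?case
  proof (cases "A = 0")
    case True
    then show ?thesis
      by (intro exI[of _ "[]"]) simp
  next
    case False
    have sym: "A \<in> sym_mats" and psd: "\<And>x. 0 \<le> x \<bullet> (A *v x)"
      using less.prems by (auto simp: psd_mats_def)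
    obtain v where v: "0 < v \<bullet> (A *v v)"
      using sym_mats_zero_form_imp_zero[OF sym] False psd
      by (metis order_le_less)
    define c where "c = v \<bullet> (A *v v)"
    define A' where "A' = A - (1 / c) *\<^sub>R outer (A *v v)"
    note A' = psd_split_off_outer[OF less.prems v, folded c_def, folded A'_def]
    have sub: "span {x. M *v x = 0} = {x. M *v x = 0}" for M :: "real^'n^'n"
      by (simp add: span_eq_iff subspace_def matrix_vector_right_distrib
          matrix_vector_mult_scaleR)
    have "{x. A *v x = 0} \<subset> {x. A' *v x = 0}"
    proof (rule psubsetI)
      show "{x. A *v x = 0} \<subseteq> {x. A' *v x = 0}"
        using A'(2) by blast
      have "A *v v \<noteq> 0"
        using v by auto
      then show "{x. A *v x = 0} \<noteq> {x. A' *v x = 0}"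
        using A'(3) by blast
    qed
    then have "span {x. A *v x = 0} \<subset> span {x. A' *v x = 0}"
      unfolding sub .
    then have dim: "dim {x. A *v x = 0} < dim {x. A' *v x = 0}"
      by (rule dim_psubset)
    have dim_le: "dim {x. A' *v x = 0} \<le> CARD('n)"
      using dim_subset_UNIV[of "{x. A' *v x = 0}"] by simp
    obtain xs where xs: "A' = (\<Sum>x\<leftarrow>xs. outer x)"
      using less.hyps[OF diff_less_mono2[OF dim order_less_le_trans[OF dim dim_le]] A'(1)]
      by blast
    have "(1 / c) *\<^sub>R outer (A *v v) = outer ((1 / sqrt c) *\<^sub>R (A *v v))"
      using v by (simp add: outer_scaleR c_def power_divide)
    moreover have "A = (1 / c) *\<^sub>R outer (A *v v) + A'"
      by (simp add: A'_def)
    ultimately have "A = (\<Sum>x\<leftarrow>((1 / sqrt c) *\<^sub>R (A *v v)) # xs. outer x)"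
      unfolding list.map sum_list.Cons xs by (metis)
    then show ?thesis
      by blast
  qed
qed

section \<open>Decomposition along a null quadratic form\<close>

text \<open>
  Rotating the pair \<open>(x, y)\<close> does not change \<open>x x\<^sup>T + y y\<^sup>T\<close>. A quarter turn takes the first vector
  from \<open>x\<close> to \<open>y\<close>, so if the form has opposite signs there, it vanishes at some angle in between.
\<close>
lemma rotate_pair_to_null:
  fixes A :: "real^'n^'n"
  assumes x: "0 < A \<bullet> outer x" and y: "A \<bullet> outer y < 0"
  shows "\<exists>p r. A \<bullet> outer p = 0 \<and> outer p + outer r = outer x + outer y"
proof -
  define p where "p \<theta> = cos \<theta> *\<^sub>R x + sin \<theta> *\<^sub>R y" for \<theta>
  define r where "r \<theta> = (- sin \<theta>) *\<^sub>R x + cos \<theta> *\<^sub>R y" for \<theta>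
  have "continuous_on {0..pi/2} (\<lambda>\<theta>. A \<bullet> outer (p \<theta>))"
    unfolding inner_outer p_def matrix_vector_mult_def by (intro continuous_intros)
  then obtain \<theta> where \<theta>: "A \<bullet> outer (p \<theta>) = 0"
    using IVT2'[of "\<lambda>\<theta>. A \<bullet> outer (p \<theta>)" "pi/2" 0 0] x y by (force simp: p_def)
  have "outer (p \<theta>) + outer (r \<theta>) = outer x + outer y"
  proof -
    have "(cos \<theta> * a + sin \<theta> * b) * (cos \<theta> * a' + sin \<theta> * b')
        + (- sin \<theta> * a + cos \<theta> * b) * (- sin \<theta> * a' + cos \<theta> * b')
        = ((sin \<theta>)\<^sup>2 + (cos \<theta>)\<^sup>2) * (a * a' + b * b')" for a b a' b' :: real
      by (simp only: power2_eq_square) (simp only: algebra_simps)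
    then show ?thesis
      by (simp add: outer_def p_def r_def vec_eq_iff)
  qed
  with \<theta> show ?thesis
    by blast
qed

lemma inner_sum_list: "a \<bullet> (\<Sum>x\<leftarrow>xs. f x) = (\<Sum>x\<leftarrow>xs. a \<bullet> f x)"
  by (induction xs) (simp_all add: inner_add_right)

text \<open>
  As long as some value of the form is nonzero, two values have opposite signs, and a rotation of
  this pair produces one null vector, which can be set aside.
\<close>
lemma sum_outer_null_decomposition:
  fixes A :: "real^'n^'n"
  assumes "A \<bullet> (\<Sum>x\<leftarrow>xs. outer x) = 0"
  shows "\<exists>ys. (\<Sum>y\<leftarrow>ys. outer y) = (\<Sum>x\<leftarrow>xs. outer x) \<and> (\<forall>y\<in>set ys. A \<bullet> outer y = 0)"
  using assms
proof (induction xs rule: length_induct)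
  case (1 xs)
  let ?q = "\<lambda>x. A \<bullet> outer x"
  have sum0: "(\<Sum>x\<leftarrow>xs. ?q x) = 0"
    using 1 by (simp add: inner_sum_list)
  show ?case
  proof (cases "\<forall>x\<in>set xs. ?q x = 0")
    case True
    then show ?thesis
      by blast
  next
    case False
    have "\<exists>x\<in>set xs. 0 < ?q x"
    proof (rule ccontr)
      assume "\<not> ?thesis"
      then have "\<forall>x\<in>set (map (\<lambda>x. - ?q x) xs). 0 \<le> x"
        by (auto simp: not_less)
      moreover have "sum_list (map (\<lambda>x. - ?q x) xs) = 0"
        using sum0 by (simp add: uminus_sum_list_map[unfolded o_def, symmetric])
      ultimately show False
        using False sum_list_nonneg_eq_0_iff[of "map (\<lambda>x. - ?q x) xs"]
        by (metis (no_types, lifting) image_eqI list.set_map neg_equal_0_iff_equal)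
    qed
    then obtain x where x: "x \<in> set xs" "0 < ?q x"
      by blast
    have "\<exists>y\<in>set xs. ?q y < 0"
    proof (rule ccontr)
      assume "\<not> ?thesis"
      then have "\<forall>y\<in>set (map ?q xs). 0 \<le> y"
        by (auto simp: not_less)
      then show False
        using False sum0 sum_list_nonneg_eq_0_iff[of "map ?q xs"] by auto
    qed
    then obtain y where y: "y \<in> set xs" "?q y < 0"
      by blast
    define zs where "zs = remove1 y (remove1 x xs)"
    have y': "y \<in> set (remove1 x xs)"
      using x y by (metis in_set_remove1 less_asym)
    have len: "length xs = Suc (Suc (length zs))"
      using x(1) y' length_pos_if_in_set[OF x(1)] length_pos_if_in_set[OF y']
      by (simp add: zs_def length_remove1)
    have split: "(\<Sum>x\<leftarrow>xs. outer x) = outer x + (outer y + (\<Sum>z\<leftarrow>zs. outer z))"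
      using sum_list_map_remove1[OF x(1), of outer] sum_list_map_remove1[OF y', of outer]
      by (simp add: zs_def)
    obtain p r where pr: "?q p = 0" "outer p + outer r = outer x + outer y"
      using rotate_pair_to_null[OF x(2) y(2)] by blast
    have eq: "outer p + (\<Sum>z\<leftarrow>r # zs. outer z) = (\<Sum>x\<leftarrow>xs. outer x)"
      using pr(2) split by (simp add: add.assoc[symmetric])
    then have "A \<bullet> (\<Sum>z\<leftarrow>r # zs. outer z) = 0"
      using 1(2) pr(1) by (metis add_0 inner_add_right)
    then obtain ys where "(\<Sum>y\<leftarrow>ys. outer y) = (\<Sum>z\<leftarrow>r # zs. outer z)"
        "\<forall>y\<in>set ys. ?q y = 0"
      using 1(1) len by (metis length_Cons lessI)
    then show ?thesis
      using eq pr(1) by (intro exI[of _ "p # ys"]) simp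
  qed
qed

lemma psd_null_decomposition:
  fixes A X :: "real^'n^'n"
  assumes "X \<in> psd_mats" "A \<bullet> X = 0"
  obtains xs where "X = (\<Sum>x\<leftarrow>xs. outer x)" "\<And>x. x \<in> set xs \<Longrightarrow> A \<bullet> outer x = 0"
proof -
  obtain zs where zs: "X = (\<Sum>x\<leftarrow>zs. outer x)"
    using psd_sum_outer[OF assms(1)] by blast
  obtain ys where ys: "(\<Sum>y\<leftarrow>ys. outer y) = (\<Sum>x\<leftarrow>zs. outer x)"
      "\<forall>y\<in>set ys. A \<bullet> outer y = 0"
    using sum_outer_null_decomposition assms(2) unfolding zs by blast
  show ?thesis
  proof (rule that)
    show "X = (\<Sum>x\<leftarrow>ys. outer x)"
      by (rule trans[OF zs ys(1)[symmetric]])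
  qed (use ys(2) in blast)
qed

section \<open>Faces and optimal solutions\<close>

lemma convex_cone_sum_list:
  assumes "cone K" "convex K" "K \<noteq> {}" "set Xs \<subseteq> K"
  shows "sum_list Xs \<in> K"
  using assms(4)
proof (induction Xs)
  case Nil
  have "0 \<in> K"
    using cone_contains_0[OF assms(1)] assms(3) by blast
  then show ?case
    by simp
next
  case (Cons X Xs)
  have "X + sum_list Xs \<in> K"
    using Cons convex_cone[of K] assms(1,2) by (metis insert_subset list.simps(15))
  then show ?case
    by simp
qed

lemma cone_face_sum_list:
  assumes "cone_face F K" "cone K" "convex K" "set Xs \<subseteq> K" "sum_list Xs \<in> F"
  shows "set Xs \<subseteq> F"
  using assms(4,5)
proof (induction Xs)
  case (Cons X Xs)
  have "sum_list Xs \<in> K"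
    using Cons.prems(1) assms(2,3) by (intro convex_cone_sum_list) auto
  then have "X \<in> F \<and> sum_list Xs \<in> F"
    using Cons.prems assms(1) by (auto simp: cone_face_def)
  then show ?case
    using Cons by auto
qed simp

lemma cop_optimal_iff:
  "cop_optimal C Q H X \<longleftrightarrow>
     X \<in> C \<and> H \<bullet> X = 1 \<and> (\<forall>Z\<in>C. H \<bullet> Z = 1 \<longrightarrow> Q \<bullet> X \<le> Q \<bullet> Z)"
proof
  assume opt: "cop_optimal C Q H X"
  have "Q \<bullet> X \<le> Q \<bullet> Z" if "Z \<in> C" "H \<bullet> Z = 1" for Z
  proof -
    have "cop_value C Q H \<le> ereal (Q \<bullet> Z)"
      unfolding cop_value_def using that by (intro INF_lower) (simp add: cop_feasible_def)
    then show ?thesis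
      using opt by (metis cop_optimal_def ereal_less_eq(3))
  qed
  with opt show "X \<in> C \<and> H \<bullet> X = 1 \<and> (\<forall>Z\<in>C. H \<bullet> Z = 1 \<longrightarrow> Q \<bullet> X \<le> Q \<bullet> Z)"
    by (auto simp: cop_optimal_def cop_feasible_def)
next
  assume "X \<in> C \<and> H \<bullet> X = 1 \<and> (\<forall>Z\<in>C. H \<bullet> Z = 1 \<longrightarrow> Q \<bullet> X \<le> Q \<bullet> Z)"
  then show "cop_optimal C Q H X"
    by (auto simp: cop_optimal_def cop_value_def cop_feasible_def
        intro!: antisym INF_greatest INF_lower)
qed

text \<open>
  The multiplier \<open>t\<close> acts as a price for the normalization \<open>H \<bullet> X = 1\<close>: on feasible points \<open>Q - t H\<close> is
  the gap between the objective and \<open>t\<close>.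
\<close>
lemma cop_optimal_if_price:
  assumes "X \<in> C" "H \<bullet> X = 1" "(Q - t *\<^sub>R H) \<bullet> X = 0"
    and "\<And>Z. Z \<in> C \<Longrightarrow> 0 \<le> (Q - t *\<^sub>R H) \<bullet> Z"
  shows "cop_optimal C Q H X"
  using assms by (fastforce simp: cop_optimal_iff inner_diff_left)

text \<open>
  The face property and (C2), (C3) put each null piece \<open>x x\<^sup>T\<close> of \<open>X\<close> into the relaxation cone, where
  the values of \<open>Q - t H\<close> cannot cancel; some piece with \<open>H \<bullet> x x\<^sup>T > 0\<close> is then optimal after scaling.
  Nonnegativity of \<open>Q - t H\<close> is assumed on the whole cone, not only where \<open>H\<close> is positive, because
  other pieces may have \<open>H \<bullet> x x\<^sup>T \<le> 0\<close>.
\<close>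
lemma exact_if_active_constraint:
  fixes G K F \<B> :: "(real^'n^'n) set"
  assumes G: "G \<subseteq> psd_mats" "cone G"
    and K: "cone K" "convex K"
    and F: "cone_face F K" "G \<subseteq> F"
    and C2: "\<forall>A\<in>\<B>. J_zero A \<subseteq> K \<and> F \<inter> J_zero A \<subseteq> G"
    and C3: "\<forall>A\<in>\<B>. \<forall>A'\<in>\<B>. A \<noteq> A' \<longrightarrow> F \<inter> J_zero A \<subseteq> F \<inter> J_plus A'"
    and nonneg: "\<And>Z. Z \<in> G \<inter> J_plus_set \<B> \<Longrightarrow> 0 \<le> (Q - t *\<^sub>R H) \<bullet> Z"
    and X: "X \<in> G" "H \<bullet> X = 1" "(Q - t *\<^sub>R H) \<bullet> X = 0"
    and A: "A \<in> \<B>" "A \<bullet> X = 0"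
  shows "exact_convex_relaxation (G \<inter> J_plus_set \<B>) Q H"
proof -
  let ?P = "Q - t *\<^sub>R H"
  obtain xs where xs: "X = (\<Sum>x\<leftarrow>xs. outer x)" "\<And>x. x \<in> set xs \<Longrightarrow> A \<bullet> outer x = 0"
    using psd_null_decomposition X(1) G(1) A(2) by blast
  have J0: "outer x \<in> J_zero A" if "x \<in> set xs" for x
    using xs(2)[OF that] outer_in_psd_mats by (simp add: J_zero_def)
  have "set (map outer xs) \<subseteq> F"
    using J0 C2 A(1) X(1) F xs(1) by (intro cone_face_sum_list[OF F(1) K]) auto
  then have F_piece: "outer x \<in> F" if "x \<in> set xs" for x
    using that by auto
  have piece: "outer x \<in> G \<inter> J_plus_set \<B>" if "x \<in> set xs" for x
  proof -
    have "0 \<le> A' \<bullet> outer x" if A': "A' \<in> \<B>" for A'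
    proof (cases "A = A'")
      case True
      then show ?thesis
        using xs(2) \<open>x \<in> set xs\<close> by simp
    next
      case False
      then have "F \<inter> J_zero A \<subseteq> F \<inter> J_plus A'"
        using C3 A(1) A' by simp
      then have "outer x \<in> J_plus A'"
        using J0[OF \<open>x \<in> set xs\<close>] F_piece[OF \<open>x \<in> set xs\<close>] by blast
      then show ?thesis
        by (simp add: J_plus_def)
    qed
    moreover have "outer x \<in> G"
      using C2 A(1) J0[OF that] F_piece[OF that] by blast
    ultimately show ?thesis
      using outer_in_psd_mats by (simp add: J_plus_set_def)
  qed
  have "(\<Sum>x\<leftarrow>xs. ?P \<bullet> outer x) = 0"
    using X(3) xs(1) by (simp add: inner_sum_list)
  then have P0: "?P \<bullet> outer x = 0" if "x \<in> set xs" for x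
    using that nonneg[OF piece] sum_list_nonneg_eq_0_iff[of "map (\<lambda>x. ?P \<bullet> outer x) xs"]
    by auto
  have "\<exists>x\<in>set xs. 0 < H \<bullet> outer x"
  proof (rule ccontr)
    assume "\<not> ?thesis"
    then have "(\<Sum>x\<leftarrow>xs. H \<bullet> outer x) \<le> 0"
      by (intro sum_list_nonpos) (auto simp: not_less)
    then show False
      using X(2) xs(1) by (simp add: inner_sum_list)
  qed
  then obtain x where x: "x \<in> set xs" "0 < H \<bullet> outer x"
    by blast
  define c where "c = 1 / (H \<bullet> outer x)"
  have c: "0 < c" "c * (H \<bullet> outer x) = 1"
    using x(2) by (auto simp: c_def)
  have scaled: "c *\<^sub>R outer x = outer (sqrt c *\<^sub>R x)"
    using c(1) by (simp add: outer_scaleR)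
  have "c *\<^sub>R outer x \<in> psd_mats"
    unfolding scaled by (rule outer_in_psd_mats)
  moreover have "c *\<^sub>R outer x \<in> G"
    using G(2) piece[OF x(1)] c(1) by (auto simp: cone_def)
  ultimately have "c *\<^sub>R outer x \<in> G \<inter> J_plus_set \<B>"
    using piece[OF x(1)] c(1) by (auto simp: J_plus_set_def)
  moreover have "H \<bullet> (c *\<^sub>R outer x) = 1" "?P \<bullet> (c *\<^sub>R outer x) = 0"
    using c(2) P0[OF x(1)] by simp_all
  ultimately have "cop_optimal (G \<inter> J_plus_set \<B>) Q H (c *\<^sub>R outer x)"
    using nonneg by (intro cop_optimal_if_price[of _ _ _ _ t])
  then show ?thesis
    by (auto simp: exact_convex_relaxation_def Gamma_eq_range_outer scaled)
qed

section \<open>Exactness of the constrained relaxation\<close>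

theorem theorem3p1:
  fixes G K F :: "(real^'n^'n) set"
    and Q H :: "real^'n^'n"
    and m :: nat
    and B :: "nat \<Rightarrow> real^'n^'n"
    and \<B> :: "(real^'n^'n) set"
  assumes G: "closed_convex_psd_cone G"
    and K: "closed_convex_psd_cone K"
    and GK: "G \<subseteq> K"
    and Q: "Q \<in> sym_mats"
    and H: "H \<in> sym_mats" "H \<noteq> 0"
    and \<B>: "\<B> = B ` {1..m}" "\<B> \<subseteq> sym_mats"
    and F: "cone_face F K" "G \<subseteq> F"
    and C1: "cop_solvable G Q H \<longrightarrow> exact_convex_relaxation G Q H"
    and C2: "\<forall>A\<in>\<B>. J_zero A \<subseteq> K \<and> F \<inter> J_zero A \<subseteq> G"
    and C3: "\<forall>A\<in>\<B>. \<forall>A'\<in>\<B>. A \<noteq> A' \<longrightarrow> F \<inter> J_zero A \<subseteq> F \<inter> J_plus A'"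
    and C4: "\<exists>X. cop_optimal (G \<inter> J_plus_set \<B>) Q H X \<and>
               (\<exists>t y Y. kkt (F \<inter> G) Q H m B X t y Y \<and> dual_optimal (F \<inter> G) Q H m B t y Y)"
  shows "exact_convex_relaxation (G \<inter> J_plus_set \<B>) Q H"
proof -
  have Gp: "G \<subseteq> psd_mats" "cone G" "convex G" and Kc: "cone K" "convex K"
    using G K by (auto simp: closed_convex_psd_cone_def)
  have FG: "F \<inter> G = G"
    using F(2) by blast
  obtain X t y Y where kkt: "kkt G Q H m B X t y Y"
    using C4 FG by auto
  let ?P = "Q - t *\<^sub>R H"
  have X: "X \<in> G" "\<forall>k\<in>{1..m}. 0 \<le> B k \<bullet> X" "H \<bullet> X = 1"
    and y: "\<forall>k\<in>{1..m}. 0 \<le> y k"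
    and Y: "\<forall>Z\<in>G. 0 \<le> Y \<bullet> Z"
    and compl: "(\<Sum>k=1..m. y k * (B k \<bullet> X)) = 0" "Y \<bullet> X = 0"
    using kkt by (auto simp: kkt_def dual_feasible_def dual_cone_def)
  have "?P = Y + (\<Sum>k=1..m. y k *\<^sub>R B k)"
    using kkt by (auto simp: kkt_def dual_feasible_def algebra_simps)
  then have expand: "?P \<bullet> Z = Y \<bullet> Z + (\<Sum>k=1..m. y k * (B k \<bullet> Z))" for Z
    by (simp add: inner_add_left inner_sum_left)
  have PX: "?P \<bullet> X = 0"
    using expand compl by simp
  have nonneg: "0 \<le> ?P \<bullet> Z" if "Z \<in> G \<inter> J_plus_set \<B>" for Z
    unfolding expand using that Y y \<B>(1)
    by (intro add_nonneg_nonneg sum_nonneg mult_nonneg_nonneg) (auto simp: J_plus_set_def)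
  note active = exact_if_active_constraint[OF Gp(1,2) Kc F C2 C3 nonneg]
  show ?thesis
  proof (cases "\<exists>A\<in>\<B>. A \<bullet> X = 0")
    case True
    then show ?thesis
      using active X PX by blast
  next
    case False
    then have pos: "0 < A \<bullet> X" if "A \<in> \<B>" for A
      using X(2) \<B>(1) that by force
    have "y k = 0" if "k \<in> {1..m}" for k
    proof -
      have "\<forall>k\<in>{1..m}. y k * (B k \<bullet> X) = 0"
        using compl(1) X(2) y by (subst (asm) sum_nonneg_eq_0_iff) auto
      then show ?thesis
        using pos[of "B k"] that \<B>(1) by fastforce
    qed
    then have nonneg_G: "0 \<le> ?P \<bullet> Z" if "Z \<in> G" for Z
      using that Y by (simp add: expand)
    have optX: "cop_optimal G Q H X"
      using X PX nonneg_G by (intro cop_optimal_if_price[of _ _ _ _ t])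
    then obtain X' where X': "X' \<in> Gamma" "cop_optimal G Q H X'"
      using C1 by (auto simp: cop_solvable_def exact_convex_relaxation_def)
    have X'_G: "X' \<in> G" "H \<bullet> X' = 1"
      using X'(2) by (auto simp: cop_optimal_iff)
    have "Q \<bullet> X' = Q \<bullet> X"
      using optX X'(2) by (auto simp: cop_optimal_iff intro: antisym)
    then have PX': "?P \<bullet> X' = 0"
      using PX X(3) X'_G(2) by (simp add: inner_diff_left)
    show ?thesis
    proof (cases "X' \<in> J_plus_set \<B>")
      case True
      then have "cop_optimal (G \<inter> J_plus_set \<B>) Q H X'"
        using X'_G PX' nonneg by (intro cop_optimal_if_price[of _ _ _ _ t]) auto
      then show ?thesis
        using X'(1) by (auto simp: exact_convex_relaxation_def)
    next
      case False
      then obtain A where A: "A \<in> \<B>" "A \<bullet> X' < 0"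
        using X'_G(1) Gp(1) by (auto simp: J_plus_set_def not_le)
      \<comment> \<open>the point where the segment from \<open>X\<close> to \<open>X'\<close> crosses the hyperplane \<open>A \<bullet> Z = 0\<close>\<close>
      define l where "l = (A \<bullet> X) / (A \<bullet> X - A \<bullet> X')"
      define Z where "Z = (1 - l) *\<^sub>R X + l *\<^sub>R X'"
      have d: "0 < A \<bullet> X - A \<bullet> X'"
        using pos[OF A(1)] A(2) by simp
      have l: "0 \<le> l" "l \<le> 1"
        using pos[OF A(1)] A(2) d by (auto simp: l_def)
      have "l * (A \<bullet> X - A \<bullet> X') = A \<bullet> X"
        using d by (simp add: l_def)
      then have AZ: "A \<bullet> Z = 0"
        by (simp add: Z_def inner_add_right algebra_simps)
      have Z_G: "Z \<in> G"
        unfolding Z_def using Gp(3) X(1) X'_G(1) l by (simp add: convex_alt)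
      have HZ: "H \<bullet> Z = 1"
        using X(3) X'_G(2) by (simp add: Z_def inner_add_right)
      have PZ: "?P \<bullet> Z = 0"
        unfolding Z_def by (simp only: inner_add_right inner_scaleR_right PX PX'
            mult_zero_right add_0)
      show ?thesis
        by (rule active[OF _ Z_G HZ PZ A(1) AZ])
    qed
  qed
qed

end
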